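(* Let $m \geq 1$ and $k \geq 0$ be integers, let $S \in L^{1}(\mathbb{R})$, and let $[a,b] \subset \mathbb{R}$ be a compact interval with $a<b$. Suppose that $S \in C^{m}([a,b])$ and that the derivative $S^{(m+1)}$ exists and is bounded on the open interval $(a,b)$. For $\varepsilon>0$ let $$S_{\varepsilon}^{m,k}(x) = (S \ast \delta^{m,k}_{\varepsilon})(x) = \int_{\mathbb{R}} S(\xi)\,\delta^{m,k}_{\varepsilon}(x-\xi)\,\mathrm{d}\xi .$$ Then $S_{\varepsilon}^{m,k}(x) \to S(x)$ as $\varepsilon \to 0^{+}$ for every $x \in (a,b)$. Moreover, $$S_{\varepsilon}^{m,k}(x) - S(x) = \mathcal{O}(\varepsilon^{m+1}) \quad \text{for } x \in (a + \varepsilon , b - \varepsilon),$$ that is, there is a constant $C$, independent of $\varepsilon$ and $x$, such that $|S_{\varepsilon}^{m,k}(x) - S(x)| \leq C\varepsilon^{m+1}$ for all $0<\varepsilon<(b-a)/2$ and all $x \in (a+\varepsilon, b-\varepsilon)$.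
   Context: For integers $m \geq 1$ and $k \geq 0$, let $P^{m,k}:[-1,1]\to\mathbb{R}$ denote the unique polynomial of degree at most $2\left(\lfloor m/2 \rfloor + k + 1\right)$ satisfying (1) $\int_{-1}^{1} P^{m,k}(\xi)\,\mathrm{d}\xi = 1$; (2) $(P^{m,k})^{(i)}(\pm 1) = 0$ for $i = 0,\ldots,k$; (3) $\int_{-1}^{1} \xi^{i} P^{m,k}(\xi)\,\mathrm{d}\xi = 0$ for $i = 1,\ldots,m$. It contains only even powers of $\xi$. (Existence and uniqueness of $P^{m,k}$ are known.) For $\varepsilon > 0$ define $$\delta^{m,k}_{\varepsilon}(x) = \begin{cases} \dfrac{1}{\varepsilon} P^{m,k}\!\left(\dfrac{x}{\varepsilon}\right), & |x| \leq \varepsilon,\\ 0, & |x| > \varepsilon. \end{cases}$$ Here $S$ is a fixed function (not merely an a.e. equivalence class), and $S \in C^m([a,b])$ means that the restriction of $S$ to $[a,b]$ is $m$ times continuously differentiable (one-sided derivatives at the endpoints). *)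

theory Defs
  imports "HOL-Analysis.Analysis"
begin

definition is_delta_poly :: "nat \<Rightarrow> nat \<Rightarrow> real poly \<Rightarrow> bool" where
  "is_delta_poly m k P \<longleftrightarrow>
     degree P \<le> 2 * (m div 2 + k + 1) \<and>
     integral {-1..1} (poly P) = 1 \<and>
     (\<forall>i\<le>k. poly ((pderiv ^^ i) P) 1 = 0 \<and> poly ((pderiv ^^ i) P) (-1) = 0) \<and>
     (\<forall>i\<in>{1..m}. integral {-1..1} (\<lambda>x. x ^ i * poly P x) = 0)"

definition delta_poly :: "nat \<Rightarrow> nat \<Rightarrow> real poly" where
  "delta_poly m k = (THE P. is_delta_poly m k P)"

definition delta_reg :: "nat \<Rightarrow> nat \<Rightarrow> real \<Rightarrow> real \<Rightarrow> real" where
  "delta_reg m k \<epsilon> x =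
     (if \<bar>x\<bar> \<le> \<epsilon> then 1 / \<epsilon> * poly (delta_poly m k) (x / \<epsilon>) else 0)"

definition convolution :: "(real \<Rightarrow> real) \<Rightarrow> (real \<Rightarrow> real) \<Rightarrow> real \<Rightarrow> real" where
  "convolution f g x = (LINT \<xi>|lebesgue. f \<xi> * g (x - \<xi>))"

text \<open>
  The derivative relative to a set \<open>A\<close>: two-sided at interior points, one-sided at the
  endpoints of an interval. It depends only on the restriction of the function to \<open>A\<close>.
\<close>

definition deriv_within :: "real set \<Rightarrow> (real \<Rightarrow> real) \<Rightarrow> real \<Rightarrow> real" where
  "deriv_within A f x = vector_derivative f (at x within A)"

definition C_on :: "nat \<Rightarrow> real set \<Rightarrow> (real \<Rightarrow> real) \<Rightarrow> bool" where
  "C_on m A f \<longleftrightarrow>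
     (\<forall>i<m. (deriv_within A ^^ i) f differentiable_on A) \<and>
     (\<forall>i\<le>m. continuous_on A ((deriv_within A ^^ i) f))"

text \<open>
  Existence and uniqueness of the polynomial selected by \<open>delta_poly\<close>. The boundary conditions
  say that \<open>P = w Q\<close> with \<open>w = (1 - \<xi>\<^sup>2)\<^sup>k\<^sup>+\<^sup>1\<close>; the moment conditions then make \<open>Q\<close> a multiple of the
  component of the constant \<open>1\<close> that is orthogonal, for the weight \<open>w\<close>, to the other even monomials.
\<close>

lemma higher_pderiv_diff: "(pderiv ^^ i) (p - q) = (pderiv ^^ i) p - (pderiv ^^ i) (q :: real poly)"
  by (induction i arbitrary: p q) (simp_all add: funpow_Suc_right pderiv_diff del: funpow.simps)

lemma power_dvd_iff_higher_pderiv: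
  fixes p :: "real poly"
  shows "[:-a, 1:] ^ Suc k dvd p \<longleftrightarrow> (\<forall>i\<le>k. poly ((pderiv ^^ i) p) a = 0)"
proof (induction k arbitrary: p)
  case 0
  show ?case by (simp add: poly_eq_0_iff_dvd)
next
  case (Suc k)
  have "(\<forall>i\<le>Suc k. poly ((pderiv ^^ i) p) a = 0) \<longleftrightarrow>
      poly p a = 0 \<and> (\<forall>i\<le>k. poly ((pderiv ^^ i) (pderiv p)) a = 0)"
    by (simp add: All_less_Suc2 less_Suc_eq_le[symmetric] funpow_Suc_right
        del: funpow.simps)
  also have "\<dots> \<longleftrightarrow> poly p a = 0 \<and> [:-a, 1:] ^ Suc k dvd pderiv p"
    using Suc[of "pderiv p"] by simp
  also have "\<dots> \<longleftrightarrow> [:-a, 1:] ^ Suc (Suc k) dvd p"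
  proof (cases "pderiv p = 0")
    case True
    then obtain c where "p = [:c:]" by (metis pderiv_iszero)
    moreover have "\<not> [:-a, 1:] ^ Suc (Suc k) dvd [:c:]" if "c \<noteq> 0"
      using that dvd_imp_degree_le[of "[:-a, 1:] ^ Suc (Suc k)" "[:c:]"]
      by (auto simp: degree_power_eq simp del: power_Suc)
    ultimately show ?thesis by (cases "c = 0") (simp_all del: power_Suc)
  next
    case False
    then have "p \<noteq> 0" by auto
    then show ?thesis
      using False order_pderiv[of p a]
      by (cases "order a p = 0") (simp_all del: power_Suc add: order_divides order_root)
  qed
  finally show ?case by blast
qed

lemma integral_poly_pos:
  fixes p :: "real poly"
  assumes "\<And>x. x \<in> {-1..1} \<Longrightarrow> poly p x \<ge> 0" "p \<noteq> 0"
  shows "integral {-1..1} (poly p) > 0"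
proof -
  have c: "continuous_on {-1..1} (poly p)" by (intro continuous_intros)
  have "integral {-1..1} (poly p) \<noteq> 0"
  proof
    assume "integral {-1..1} (poly p) = 0"
    then have "\<forall>x\<in>{-1..1}. poly p x = 0"
      using integral_eq_0_iff[OF c] assms(1) by simp
    then have "{-1..1} \<subseteq> {x. poly p x = 0}" by auto
    then show False
      using finite_subset[OF _ poly_roots_finite[OF assms(2)]] infinite_Icc[of "-1::real" 1] by simp
  qed
  moreover have "integral {-1..1} (poly p) \<ge> 0"
    using assms(1) by (intro integral_nonneg integrable_continuous_interval c) auto
  ultimately show ?thesis by simp
qed

definition wgt :: "nat \<Rightarrow> real poly" where "wgt k = [:1, 0, -1:] ^ Suc k"

definition wip :: "nat \<Rightarrow> real poly \<Rightarrow> real" where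
  "wip k f = integral {-1..1} (poly (wgt k * f))"

lemma poly_integrable [simp]: "poly (p::real poly) integrable_on {-1..1}"
  by (intro integrable_continuous_interval continuous_intros)

lemma wip_add: "wip k (f + g) = wip k f + wip k g"
proof -
  have "poly (wgt k * (f + g)) = (\<lambda>x. poly (wgt k * f) x + poly (wgt k * g) x)"
    by (auto simp: algebra_simps)
  then show ?thesis unfolding wip_def by (simp add: integral_add del: poly_mult)
qed

lemma wip_smult: "wip k (smult c f) = c * wip k f"
proof -
  have "poly (wgt k * smult c f) = (\<lambda>x. c * poly (wgt k * f) x)"
    by (auto simp: algebra_simps)
  then show ?thesis unfolding wip_def by (simp del: poly_mult)
qed

lemma wip_diff: "wip k (f - g) = wip k f - wip k g"
  using wip_add[of k "f - g" g] by simp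

lemma wgt_nz [simp]: "wgt k \<noteq> 0" by (simp add: wgt_def del: power_Suc)

lemma degree_wgt: "degree (wgt k) = 2 * (k + 1)"
  by (simp add: wgt_def degree_power_eq del: power_Suc)

lemma wip_pos: "f \<noteq> 0 \<Longrightarrow> wip k (f * f) > 0"
  unfolding wip_def
proof (rule integral_poly_pos)
  fix x :: real assume "x \<in> {-1..1}"
  then have "\<bar>x\<bar> \<le> 1" by auto
  then have "x\<^sup>2 \<le> 1" by (simp add: abs_square_le_1)
  then have "1 - x * x \<ge> 0" by (simp add: power2_eq_square)
  then have "poly (wgt k) x \<ge> 0"
    by (simp add: wgt_def poly_power del: power_Suc)
  then show "0 \<le> poly (wgt k * (f * f)) x" by simp
qed simp

definition sq :: "real poly \<Rightarrow> real poly" where "sq r = pcompose r [:0, 0, 1:]"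

lemma sq_nz: "r \<noteq> 0 \<Longrightarrow> sq r \<noteq> 0"
  by (simp add: sq_def pcompose_eq_0_iff)

lemma sq_lin: "sq (r + s) = sq r + sq s" "sq (r - s) = sq r - sq s"
  "sq (smult c r) = smult c (sq r)" "sq 1 = 1"
  by (simp_all add: sq_def pcompose_add pcompose_diff pcompose_smult pcompose_1)

lemma proj:
  "\<exists>p. degree p \<le> n \<and> coeff p 0 = 0 \<and>
     (\<forall>s. degree s \<le> n \<longrightarrow> coeff s 0 = 0 \<longrightarrow> wip k (sq (v - p) * sq s) = 0)"
proof (induction n arbitrary: v)
  case 0
  have "s = 0" if "degree s = 0" "coeff s 0 = 0" for s :: "real poly"
    using that by (metis leading_coeff_0_iff)
  moreover have "sq 0 = 0" "wip k 0 = 0" by (simp_all add: sq_def wip_def poly_0[abs_def])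
  ultimately show ?case by (intro exI[of _ 0]) (metis coeff_0 degree_0 le_zero_eq mult_zero_right)
next
  case (Suc n)
  obtain p where p: "degree p \<le> n" "coeff p 0 = 0"
    "\<And>s. degree s \<le> n \<Longrightarrow> coeff s 0 = 0 \<Longrightarrow> wip k (sq (v - p) * sq s) = 0"
    using Suc[of v] by auto
  obtain pb where pb: "degree pb \<le> n" "coeff pb 0 = 0"
    "\<And>s. degree s \<le> n \<Longrightarrow> coeff s 0 = 0 \<Longrightarrow> wip k (sq (monom 1 (Suc n) - pb) * sq s) = 0"
    using Suc[of "monom 1 (Suc n)"] by auto
  define b where "b = monom 1 (Suc n) - pb"
  have cb: "coeff b (Suc n) = 1" using pb(1) by (simp add: b_def coeff_eq_0)
  have b0: "coeff b 0 = 0" using pb(2) by (simp add: b_def)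
  have db: "degree b \<le> Suc n" unfolding b_def
    by (intro degree_diff_le) (use pb(1) in \<open>auto simp: degree_monom_eq\<close>)
  have bb: "wip k (sq b * sq b) > 0" using cb by (intro wip_pos sq_nz) auto
  define c where "c = wip k (sq (v - p) * sq b) / wip k (sq b * sq b)"
  define p' where "p' = p + smult c b"
  have "degree p' \<le> Suc n" unfolding p'_def
    using p(1) db by (intro degree_add_le) (auto intro: order.trans[OF degree_smult_le])
  moreover have "coeff p' 0 = 0" using p(2) b0 by (simp add: p'_def)
  moreover have "wip k (sq (v - p') * sq s) = 0"
    if s: "degree s \<le> Suc n" "coeff s 0 = 0" for s
  proof -
    define s' where "s' = s - smult (coeff s (Suc n)) b"
    have "degree s' \<le> Suc n" unfolding s'_def
      using s db by (intro degree_diff_le) (auto intro: order.trans[OF degree_smult_le])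
    moreover have "coeff s' (Suc n) = 0" using cb by (simp add: s'_def)
    ultimately have ds': "degree s' \<le> n"
      by (metis le_SucE degree_0 leading_coeff_0_iff zero_le)
    have s'0: "coeff s' 0 = 0" using s b0 by (simp add: s'_def)
    have e: "s = s' + smult (coeff s (Suc n)) b" by (simp add: s'_def)
    have 1: "v - p' = (v - p) - smult c b" by (simp add: p'_def)
    have 2: "wip k (sq (v - p') * sq s') = 0"
      using p(3)[OF ds' s'0] pb(3)[OF ds' s'0] unfolding 1
      by (simp add: sq_lin b_def[symmetric] wip_diff wip_smult left_diff_distrib)
    have 3: "wip k (sq (v - p') * sq b) = 0"
      using bb unfolding 1
      by (simp add: sq_lin(2)[of "v - p"] sq_lin(3) wip_diff wip_smult left_diff_distrib c_def)
    show ?thesis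
      by (subst e) (simp only: sq_lin(1,3) distrib_left wip_add mult_smult_right wip_smult 2 3)
  qed
  ultimately show ?case by blast
qed

lemma wgt_dvd_iff:
  "wgt k dvd p \<longleftrightarrow>
     (\<forall>i\<le>k. poly ((pderiv ^^ i) p) 1 = 0 \<and> poly ((pderiv ^^ i) p) (-1) = 0)"
proof -
  have "wgt k = smult ((-1) ^ Suc k) ([:-1, 1:] ^ Suc k * [:1, 1:] ^ Suc k)"
    unfolding wgt_def power_mult_distrib[symmetric] smult_power[symmetric] by simp
  then have "wgt k dvd p \<longleftrightarrow> [:-1, 1:] ^ Suc k * [:1, 1:] ^ Suc k dvd p"
    by (simp add: smult_dvd_iff del: power_Suc)
  also have "\<dots> \<longleftrightarrow> [:-1, 1:] ^ Suc k dvd p \<and> [:1, 1:] ^ Suc k dvd p"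
  proof -
    have "[:-1, 1:] ^ Suc k * [:1, 1:] ^ Suc k dvd p"
      if dvds: "[:-1, 1:] ^ Suc k dvd p" "[:1, 1:] ^ Suc k dvd p"
    proof (cases "p = 0")
      case False
      obtain r where r: "p = [:-1, 1:] ^ Suc k * r" using dvds(1) by blast
      have "poly ([:-1, 1:] ^ Suc k) (-1 :: real) \<noteq> 0" by (simp add: poly_power)
      then have "order (-1) ([:-1, 1 :: real:] ^ Suc k) = 0" by (rule order_0I)
      then have "order (-1) p = order (-1) r"
        using False unfolding r by (subst order_mult) (simp_all del: power_Suc)
      moreover have "Suc k \<le> order (-1) p"
        using dvds(2) order_divides[of "-1" "Suc k" p] False by (simp del: power_Suc)
      ultimately have "[:1, 1:] ^ Suc k dvd r"
        using order_divides[of "-1" "Suc k" r] by (simp del: power_Suc)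
      then show ?thesis unfolding r by (rule mult_dvd_mono[OF dvd_refl])
    qed simp
    then show ?thesis by (metis dvd_mult_left dvd_mult_right)
  qed
  also have "\<dots> \<longleftrightarrow> (\<forall>i\<le>k. poly ((pderiv ^^ i) p) 1 = 0 \<and> poly ((pderiv ^^ i) p) (-1) = 0)"
    using power_dvd_iff_higher_pderiv[of 1 k p] power_dvd_iff_higher_pderiv[of "-1" k p] by auto
  finally show ?thesis .
qed

lemma ex_delta_poly: "\<exists>P. is_delta_poly m k P"
proof -
  define q where "q = m div 2"
  obtain p where p: "degree p \<le> q" "coeff p 0 = 0"
    "\<And>s. degree s \<le> q \<Longrightarrow> coeff s 0 = 0 \<Longrightarrow> wip k (sq (1 - p) * sq s) = 0"
    using proj[of q k 1] by auto
  define u where "u = 1 - p"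
  have du: "degree u \<le> q" unfolding u_def by (intro degree_diff_le) (use p in auto)
  have "coeff u 0 = 1" using p by (simp add: u_def)
  then have "u \<noteq> 0" by auto
  then have "wip k (sq u * sq u) > 0" by (intro wip_pos sq_nz)
  moreover have "wip k (sq u * sq p) = 0" using p by (simp add: u_def)
  moreover have "sq u * sq u = sq u - sq u * sq p"
    by (simp add: u_def sq_lin algebra_simps)
  ultimately have pos: "wip k (sq u) > 0" by (simp add: wip_diff)
  define P where "P = smult (1 / wip k (sq u)) (wgt k * sq u)"
  have d: "degree P \<le> 2 * (m div 2 + k + 1)"
  proof -
    have "degree P \<le> degree (wgt k) + degree (sq u)"
      unfolding P_def using degree_smult_le degree_mult_le order.trans by blast
    also have "\<dots> \<le> 2 * (m div 2 + k + 1)"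
      using du by (simp add: degree_wgt sq_def degree_pcompose q_def)
    finally show ?thesis .
  qed
  have mom: "integral {-1..1} (\<lambda>x. poly f x * poly P x) = wip k (f * sq u) / wip k (sq u)" for f
  proof -
    have "(\<lambda>x. poly f x * poly P x) = poly (wgt k * smult (1 / wip k (sq u)) (f * sq u))"
      by (auto simp: P_def)
    then show ?thesis unfolding wip_def[of k "f * sq u"]
      using wip_smult[of k "1 / wip k (sq u)" "f * sq u"] by (simp add: wip_def del: poly_mult)
  qed
  have i1: "integral {-1..1} (poly P) = 1"
    using mom[of 1] pos by simp
  have "integral {-1..1} (\<lambda>x. x ^ i * poly P x) = 0" if i: "i \<in> {1..m}" for i
  proof (cases "even i")
    case True
    then obtain j where j: "i = 2 * j" by auto
    have "poly (sq (monom 1 j)) x = x ^ i" for x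
      by (simp add: sq_def poly_pcompose poly_monom j power_mult power2_eq_square)
    moreover have "wip k (sq u * sq (monom 1 j)) = 0"
      using i j p by (auto simp: u_def q_def degree_monom_eq intro!: p(3))
    ultimately show ?thesis using mom[of "sq (monom 1 j)"] by (simp add: mult.commute)
  next
    case False
    define F where "F = (\<lambda>x. x ^ i * poly P x)"
    have "poly P (-x) = poly P x" for x
      by (simp add: P_def wgt_def sq_def poly_pcompose)
    then have "(\<lambda>x. F (-x)) = (\<lambda>x. - F x)" using False by (simp add: F_def)
    then have "integral {-1..1} F = - integral {-1..1} F"
      using Henstock_Kurzweil_Integration.integral_reflect_real[of 1 "-1" F] by simp
    then show ?thesis by (simp add: F_def)
  qed
  moreover have "wgt k dvd P" unfolding P_def by (simp add: dvd_smult)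
  ultimately have "is_delta_poly m k P"
    unfolding is_delta_poly_def wgt_dvd_iff[symmetric] using d i1 by (auto simp: wgt_dvd_iff)
  then show ?thesis ..
qed

lemma delta_poly_unique:
  assumes "is_delta_poly m k P" "is_delta_poly m k Q"
  shows "P = Q"
proof (rule ccontr)
  define D where "D = P - Q"
  assume "P \<noteq> Q"
  then have "D \<noteq> 0" by (simp add: D_def)
  have "wgt k dvd D"
    unfolding D_def using assms by (intro dvd_diff) (auto simp: is_delta_poly_def wgt_dvd_iff)
  then obtain E where E: "D = wgt k * E" by blast
  with \<open>D \<noteq> 0\<close> have "E \<noteq> 0" by auto
  have "degree D \<le> 2 * (m div 2 + k + 1)"
    unfolding D_def using assms by (intro degree_diff_le) (auto simp: is_delta_poly_def)
  then have dE: "degree E \<le> m"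
    using \<open>E \<noteq> 0\<close> by (simp add: E degree_mult_eq degree_wgt)
  have mom: "integral {-1..1} (\<lambda>x. x ^ i * poly D x) = 0" if "i \<le> m" for i
  proof -
    have int: "(\<lambda>x. x ^ i * poly p x) integrable_on {-1..1}" for p :: "real poly"
      by (intro integrable_continuous_interval continuous_intros)
    have "integral {-1..1} (\<lambda>x. x ^ i * poly P x) = integral {-1..1} (\<lambda>x. x ^ i * poly Q x)"
      using assms that by (cases "i = 0") (auto simp: is_delta_poly_def)
    then show ?thesis
      by (simp add: D_def right_diff_distrib integral_diff int)
  qed
  have "wip k (E * E) = integral {-1..1} (\<lambda>x. \<Sum>i\<le>degree E. coeff E i * (x ^ i * poly D x))"
    unfolding wip_def
  proof (rule integral_cong)
    fix x
    have "poly (wgt k * (E * E)) x = poly E x * poly D x" by (simp add: E)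
    also have "\<dots> = (\<Sum>i\<le>degree E. coeff E i * (x ^ i * poly D x))"
      by (simp add: poly_altdef[of E] sum_distrib_right mult.assoc)
    finally show "poly (wgt k * (E * E)) x = (\<Sum>i\<le>degree E. coeff E i * (x ^ i * poly D x))" .
  qed
  also have "\<dots> = (\<Sum>i\<le>degree E. coeff E i * integral {-1..1} (\<lambda>x. x ^ i * poly D x))"
    by (subst integral_sum)
       (auto intro!: integrable_continuous_interval continuous_intros)
  also have "\<dots> = 0" using dE mom by (auto intro!: sum.neutral)
  finally show False using wip_pos[OF \<open>E \<noteq> 0\<close>, of k] by simp
qed

lemma is_delta_poly_delta_poly: "is_delta_poly m k (delta_poly m k)"
  unfolding delta_poly_def using ex_delta_poly delta_poly_unique by (metis theI)

end

theory Submission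
  imports Defs
begin

text \<open>
  The substitution \<open>\<xi> = x - \<epsilon> t\<close> turns the convolution into \<open>\<integral> S(x - \<epsilon> t) P(t) dt\<close> over
  \<open>[-1, 1]\<close>, where \<open>P\<close> is the fixed polynomial \<open>delta_poly m k\<close>
  (\<open>convolution_delta_reg_eq\<close>). For \<open>a + \<epsilon> < x < b - \<epsilon>\<close> the points \<open>x - \<epsilon> t\<close> stay in
  \<open>(a, b)\<close>, so \<open>S(x - \<epsilon> t)\<close> is its Taylor polynomial of degree \<open>m\<close> at \<open>x\<close>, seen as a polynomial
  in \<open>t\<close>, plus a remainder of size at most \<open>M \<epsilon>^(m+1) / (m+1)!\<close>, where \<open>M\<close> bounds the
  derivative of order \<open>m + 1\<close> (\<open>taylor_remainder_le\<close>). Integration against \<open>P\<close> returns the constant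
  term \<open>S x\<close> and annihilates the powers \<open>t, \<dots>, t^m\<close> (\<open>integral_polynomial_delta_poly\<close>), so the
  error is the integral of the remainder against \<open>P\<close>, at most
  \<open>M \<epsilon>^(m+1) / (m+1)! * \<integral> \<bar>P\<bar>\<close>. This constant depends neither on \<open>x\<close> nor on \<open>\<epsilon>\<close>, and
  pointwise convergence follows because each \<open>x \<in> (a, b)\<close> lies in \<open>(a + \<epsilon>, b - \<epsilon>)\<close> for all
  small \<open>\<epsilon>\<close>.
\<close>

lemma has_real_derivative_deriv_within:
  assumes "g differentiable_on {a..b}" and "x \<in> {a<..<b}"
  shows "(g has_real_derivative deriv_within {a..b} g x) (at x)"
proof -
  have at_x: "at x within {a..b} = at x"
    using assms(2) by (intro at_within_interior) auto
  have "g differentiable (at x within {a..b})"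
    using assms unfolding differentiable_on_def by auto
  then show ?thesis
    unfolding at_x deriv_within_def
    by (simp add: vector_derivative_works has_real_derivative_iff_has_vector_derivative)
qed

text \<open>
  The induction needs the equality on the whole open interval, since a derivative at \<open>x\<close> depends
  on a neighbourhood of \<open>x\<close>.
\<close>

lemma C_on_imp_deriv_within_eq_deriv:
  assumes C: "C_on m {a..b} f" and "i \<le> m" and "x \<in> {a<..<b}"
  shows "(deriv_within {a..b} ^^ i) f x = (deriv ^^ i) f x"
  using assms(2,3)
proof (induction i arbitrary: x)
  case (Suc i)
  have "((deriv_within {a..b} ^^ i) f has_real_derivative
      deriv_within {a..b} ((deriv_within {a..b} ^^ i) f) x) (at x)"
    using C Suc.prems unfolding C_on_def by (intro has_real_derivative_deriv_within) auto
  then have "((deriv ^^ i) f has_real_derivative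
      deriv_within {a..b} ((deriv_within {a..b} ^^ i) f) x) (at x)"
    by (rule has_field_derivative_transform_within_open[of _ _ _ "{a<..<b}"])
       (use Suc in auto)
  then show ?case by (simp add: DERIV_imp_deriv)
qed simp

lemma C_on_imp_has_real_derivative:
  assumes C: "C_on m {a..b} f" and "i < m" and x: "x \<in> {a<..<b}"
  shows "((deriv ^^ i) f has_real_derivative (deriv ^^ Suc i) f x) (at x)"
proof -
  have "((deriv_within {a..b} ^^ i) f has_real_derivative (deriv_within {a..b} ^^ Suc i) f x) (at x)"
    using C \<open>i < m\<close> has_real_derivative_deriv_within[OF _ x] unfolding C_on_def by simp
  then have "((deriv ^^ i) f has_real_derivative (deriv_within {a..b} ^^ Suc i) f x) (at x)"
    by (rule has_field_derivative_transform_within_open[of _ _ _ "{a<..<b}"])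
       (use x C_on_imp_deriv_within_eq_deriv[OF C] \<open>i < m\<close> in auto)
  then show ?thesis
    using C_on_imp_deriv_within_eq_deriv[OF C _ x, of "Suc i"] \<open>i < m\<close>
    by (simp del: funpow.simps)
qed

text \<open>
  Lagrange's form of the remainder uses the derivative of order \<open>m + 1\<close> at a single intermediate
  point only, so boundedness of that derivative suffices, without continuity or integrability.
\<close>

lemma taylor_remainder_le:
  fixes f :: "real \<Rightarrow> real"
  assumes deriv: "\<And>i z. i \<le> m \<Longrightarrow> z \<in> {a<..<b} \<Longrightarrow>
      ((deriv ^^ i) f has_real_derivative (deriv ^^ Suc i) f z) (at z)"
    and bound: "\<And>z. z \<in> {a<..<b} \<Longrightarrow> \<bar>(deriv ^^ Suc m) f z\<bar> \<le> M"
    and x: "x \<in> {a<..<b}" and y: "y \<in> {a<..<b}"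
  shows "\<bar>f y - (\<Sum>i\<le>m. (deriv ^^ i) f x / fact i * (y - x) ^ i)\<bar>
      \<le> M / fact (Suc m) * \<bar>y - x\<bar> ^ Suc m"
proof (cases "y = x")
  case True
  have "(\<Sum>i\<le>m. (deriv ^^ i) f x / fact i * (y - x) ^ i) = f x"
    using True by (simp add: power_0_left if_distrib cong: if_cong)
  then show ?thesis using True by simp
next
  case False
  have "\<exists>t. (if y < x then y < t \<and> t < x else x < t \<and> t < y) \<and>
      f y = (\<Sum>i<Suc m. (deriv ^^ i) f x / fact i * (y - x) ^ i) +
        (deriv ^^ Suc m) f t / fact (Suc m) * (y - x) ^ Suc m"
    using False x y
    by (intro Taylor[where a = "min x y" and b = "max x y"])
       (auto intro!: deriv simp del: funpow.simps)
  then obtain t where "if y < x then y < t \<and> t < x else x < t \<and> t < y" and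
    f: "f y = (\<Sum>i<Suc m. (deriv ^^ i) f x / fact i * (y - x) ^ i) +
        (deriv ^^ Suc m) f t / fact (Suc m) * (y - x) ^ Suc m"
    by blast
  then have t: "t \<in> {a<..<b}"
    using x y by (auto split: if_splits)
  have "\<bar>f y - (\<Sum>i\<le>m. (deriv ^^ i) f x / fact i * (y - x) ^ i)\<bar>
      = \<bar>(deriv ^^ Suc m) f t / fact (Suc m) * (y - x) ^ Suc m\<bar>"
    unfolding f lessThan_Suc_atMost by simp
  also have "\<dots> = \<bar>(deriv ^^ Suc m) f t\<bar> / fact (Suc m) * \<bar>y - x\<bar> ^ Suc m"
    by (simp only: abs_mult abs_divide power_abs abs_of_pos[OF fact_gt_zero])
  also have "\<dots> \<le> M / fact (Suc m) * \<bar>y - x\<bar> ^ Suc m"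
    by (intro mult_right_mono divide_right_mono bound t) auto
  finally show ?thesis .
qed

lemma continuous_on_compose_reflect:
  fixes f :: "real \<Rightarrow> real"
  assumes "continuous_on {x - \<epsilon>..x + \<epsilon>} f" and "\<epsilon> > 0"
  shows "continuous_on {-1..1} (\<lambda>t. f (x - \<epsilon> * t))"
proof (rule continuous_on_compose2[OF assms(1)])
  have "\<epsilon> * t \<le> \<epsilon> \<and> - \<epsilon> \<le> \<epsilon> * t" if "t \<in> {-1..1}" for t
    using that mult_left_mono[of t 1 \<epsilon>] mult_left_mono[of "-1" t \<epsilon>] \<open>\<epsilon> > 0\<close> by auto
  then show "(\<lambda>t. x - \<epsilon> * t) ` {-1..1} \<subseteq> {x - \<epsilon>..x + \<epsilon>}"
    by fastforce
qed (intro continuous_intros)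

text \<open>
  Continuity of \<open>f\<close> on the support of the kernel makes the Lebesgue integral a
  Henstock-Kurzweil integral over a compact interval, where the affine substitution applies.
\<close>

lemma convolution_delta_reg_eq:
  assumes cont: "continuous_on {x - \<epsilon>..x + \<epsilon>} f" and \<epsilon>: "\<epsilon> > 0"
  shows "convolution f (delta_reg m k \<epsilon>) x
    = integral {-1..1} (\<lambda>t. f (x - \<epsilon> * t) * poly (delta_poly m k) t)"
proof -
  let ?P = "poly (delta_poly m k)" and ?I = "{x - \<epsilon>..x + \<epsilon>}"
  define g where "g = (\<lambda>\<xi>. f \<xi> * (1 / \<epsilon> * ?P ((x - \<xi>) / \<epsilon>)))"
  have g: "continuous_on ?I g"
    unfolding g_def using \<epsilon> by (intro continuous_intros cont) auto
  have "convolution f (delta_reg m k \<epsilon>) x = (LINT \<xi>:?I|lebesgue. g \<xi>)"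
    unfolding convolution_def set_lebesgue_integral_def
    by (rule Bochner_Integration.integral_cong)
       (auto simp: g_def delta_reg_def indicator_def abs_le_iff)
  also have "\<dots> = integral ?I g"
    by (intro set_lebesgue_integral_eq_integral(2) absolutely_integrable_continuous_real g)
  finally have conv: "convolution f (delta_reg m k \<epsilon>) x = integral ?I g" .
  have "(g has_integral integral ?I g) (cbox (x - \<epsilon>) (x + \<epsilon>))"
    using integrable_integral[OF integrable_continuous_real[OF g]] by simp
  from has_integral_affinity[OF this, of "- \<epsilon>" x]
  have "((\<lambda>t. g (x - \<epsilon> * t)) has_integral integral ?I g / \<epsilon>)
      ((\<lambda>\<xi>. (x - \<xi>) / \<epsilon>) ` {x - \<epsilon>..x + \<epsilon>})"
    using \<epsilon> by (simp add: field_simps)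
  moreover have "(\<lambda>\<xi>. (x - \<xi>) / \<epsilon>) ` {x - \<epsilon>..x + \<epsilon>} = {-1..1}"
  proof
    show "(\<lambda>\<xi>. (x - \<xi>) / \<epsilon>) ` {x - \<epsilon>..x + \<epsilon>} \<subseteq> {-1..1}"
      using \<epsilon> by (auto simp: field_simps)
    show "{-1..1} \<subseteq> (\<lambda>\<xi>. (x - \<xi>) / \<epsilon>) ` {x - \<epsilon>..x + \<epsilon>}"
    proof
      fix t :: real assume t: "t \<in> {-1..1}"
      have "\<epsilon> * t \<le> \<epsilon>" "- \<epsilon> \<le> \<epsilon> * t"
        using t mult_left_mono[of t 1 \<epsilon>] mult_left_mono[of "-1" t \<epsilon>] \<epsilon> by auto
      then show "t \<in> (\<lambda>\<xi>. (x - \<xi>) / \<epsilon>) ` {x - \<epsilon>..x + \<epsilon>}"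
        using \<epsilon> by (intro image_eqI[of _ _ "x - \<epsilon> * t"]) auto
    qed
  qed
  ultimately have "((\<lambda>t. \<epsilon> * g (x - \<epsilon> * t)) has_integral integral ?I g) {-1..1}"
    using has_integral_mult_right[of "\<lambda>t. g (x - \<epsilon> * t)" "integral ?I g / \<epsilon>" "{-1..1}" \<epsilon>] \<epsilon>
    by simp
  moreover have "(\<lambda>t. \<epsilon> * g (x - \<epsilon> * t)) = (\<lambda>t. f (x - \<epsilon> * t) * ?P t)"
    using \<epsilon> by (auto simp: g_def)
  ultimately show ?thesis using conv by (simp add: integral_unique)
qed

text \<open>
  The moment conditions say that integration against \<open>delta_poly m k\<close> acts on polynomials of degree
  at most \<open>m\<close> as evaluation at \<open>0\<close>.
\<close>

lemma integral_polynomial_delta_poly: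
  "integral {-1..1} (\<lambda>t. (\<Sum>i\<le>m. c i * t ^ i) * poly (delta_poly m k) t) = c 0"
proof -
  let ?P = "poly (delta_poly m k)"
  have P: "integral {-1..1} ?P = 1" "\<And>i. i \<in> {1..m} \<Longrightarrow> integral {-1..1} (\<lambda>t. t ^ i * ?P t) = 0"
    using is_delta_poly_delta_poly[of m k] by (auto simp: is_delta_poly_def)
  have "integral {-1..1} (\<lambda>t. (\<Sum>i\<le>m. c i * t ^ i) * ?P t)
      = integral {-1..1} (\<lambda>t. \<Sum>i\<le>m. c i * (t ^ i * ?P t))"
    by (simp add: sum_distrib_right mult.assoc)
  also have "\<dots> = (\<Sum>i\<le>m. c i * integral {-1..1} (\<lambda>t. t ^ i * ?P t))"
    by (subst integral_sum)
       (auto intro!: integrable_continuous_interval continuous_intros)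
  also have "\<dots> = (\<Sum>i\<le>m. if i = 0 then c 0 else 0)"
    using P by (intro sum.cong) auto
  finally show ?thesis by simp
qed

text \<open>
  Since the kernel reproduces the value at \<open>0\<close> of the approximating polynomial exactly, only the
  approximation error is integrated against it.
\<close>

lemma convolution_delta_reg_error_le:
  fixes f :: "real \<Rightarrow> real"
  assumes cont: "continuous_on {x - \<epsilon>..x + \<epsilon>} f" and \<epsilon>: "\<epsilon> > 0"
    and approx: "\<And>t. t \<in> {-1..1} \<Longrightarrow> \<bar>f (x - \<epsilon> * t) - (\<Sum>i\<le>m. c i * t ^ i)\<bar> \<le> B"
  shows "\<bar>convolution f (delta_reg m k \<epsilon>) x - c 0\<bar>
    \<le> B * integral {-1..1} (\<lambda>t. \<bar>poly (delta_poly m k) t\<bar>)"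
proof -
  let ?P = "poly (delta_poly m k)" and ?q = "\<lambda>t. \<Sum>i\<le>m. c i * t ^ i"
  note [continuous_intros] = continuous_on_compose_reflect[OF cont \<epsilon>]
  have "convolution f (delta_reg m k \<epsilon>) x - c 0
      = integral {-1..1} (\<lambda>t. f (x - \<epsilon> * t) * ?P t) - integral {-1..1} (\<lambda>t. ?q t * ?P t)"
    by (simp only: convolution_delta_reg_eq[OF cont \<epsilon>] integral_polynomial_delta_poly)
  also have "\<dots> = integral {-1..1} (\<lambda>t. f (x - \<epsilon> * t) * ?P t - ?q t * ?P t)"
    by (intro integral_diff[symmetric] integrable_continuous_interval continuous_intros)
  also have "\<dots> = integral {-1..1} (\<lambda>t. (f (x - \<epsilon> * t) - ?q t) * ?P t)"
    by (simp only: left_diff_distrib)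
  also have "norm \<dots> \<le> integral {-1..1} (\<lambda>t. B * \<bar>?P t\<bar>)"
    using approx
    by (intro integral_norm_bound_integral integrable_continuous_interval continuous_intros)
       (auto simp: abs_mult intro: mult_right_mono)
  finally show ?thesis by simp
qed

theorem theorem2p2:
  fixes m k :: nat and S :: "real \<Rightarrow> real" and a b :: real
  assumes "m \<ge> 1"
    and "integrable lebesgue S"
    and "a < b"
    and "C_on m {a..b} S"
    and "(deriv ^^ m) S differentiable_on {a<..<b}"
    and "bounded ((deriv ^^ (m + 1)) S ` {a<..<b})"
  shows "(\<forall>x\<in>{a<..<b}.
            ((\<lambda>\<epsilon>. convolution S (delta_reg m k \<epsilon>) x) \<longlongrightarrow> S x) (at_right 0)) \<and>
         (\<exists>C. \<forall>\<epsilon> x. 0 < \<epsilon> \<longrightarrow> \<epsilon> < (b - a) / 2 \<longrightarrow> x \<in> {a + \<epsilon><..<b - \<epsilon>} \<longrightarrow>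
            \<bar>convolution S (delta_reg m k \<epsilon>) x - S x\<bar> \<le> C * \<epsilon> ^ (m + 1))"
proof -
  have cont: "continuous_on {a..b} S"
    using \<open>C_on m {a..b} S\<close> unfolding C_on_def by (auto dest: spec[of _ 0])
  have deriv: "((deriv ^^ i) S has_real_derivative (deriv ^^ Suc i) S z) (at z)"
    if "i \<le> m" "z \<in> {a<..<b}" for i z
  proof (cases "i < m")
    case True
    then show ?thesis using C_on_imp_has_real_derivative[OF \<open>C_on m {a..b} S\<close>] that by blast
  next
    case False
    then have "i = m" using that by simp
    moreover have "(deriv ^^ m) S differentiable (at z)"
      using \<open>(deriv ^^ m) S differentiable_on {a<..<b}\<close> that(2)
      by (simp add: differentiable_on_eq_differentiable_at)
    ultimately show ?thesis
      by (auto simp: real_differentiable_def DERIV_imp_deriv)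
  qed
  obtain M where M: "\<And>z. z \<in> {a<..<b} \<Longrightarrow> \<bar>(deriv ^^ Suc m) S z\<bar> \<le> M"
    using \<open>bounded ((deriv ^^ (m + 1)) S ` {a<..<b})\<close>
    unfolding bounded_iff Suc_eq_plus1 real_norm_def by blast
  have "M \<ge> 0"
    using M[of "(a + b) / 2"] \<open>a < b\<close> by (auto simp del: funpow.simps)
  define C where
    "C = M / fact (Suc m) * integral {-1..1} (\<lambda>t. \<bar>poly (delta_poly m k) t\<bar>)"
  have error: "\<bar>convolution S (delta_reg m k \<epsilon>) x - S x\<bar> \<le> C * \<epsilon> ^ (m + 1)"
    if \<epsilon>: "\<epsilon> > 0" and x: "x \<in> {a + \<epsilon><..<b - \<epsilon>}" for \<epsilon> x
  proof -
    \<comment> \<open>coefficients in \<open>t\<close> of the Taylor polynomial of \<open>S\<close> at \<open>x\<close>, evaluated at \<open>x - \<epsilon> t\<close>\<close>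
    define c where "c i = (deriv ^^ i) S x / fact i * (- \<epsilon>) ^ i" for i
    have "\<bar>S (x - \<epsilon> * t) - (\<Sum>i\<le>m. c i * t ^ i)\<bar> \<le> M / fact (Suc m) * \<epsilon> ^ Suc m"
      if t: "t \<in> {-1..1}" for t
    proof -
      have \<epsilon>t: "\<epsilon> * t \<le> \<epsilon>" "- \<epsilon> \<le> \<epsilon> * t"
        using t mult_left_mono[of t 1 \<epsilon>] mult_left_mono[of "-1" t \<epsilon>] \<epsilon> by auto
      have inside: "x \<in> {a<..<b}" "x - \<epsilon> * t \<in> {a<..<b}"
        unfolding greaterThanLessThan_iff using x[unfolded greaterThanLessThan_iff] \<epsilon> \<epsilon>t by linarith+
      have "(deriv ^^ i) S x / fact i * (x - \<epsilon> * t - x) ^ i = c i * t ^ i" for i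
        by (simp add: c_def flip: power_mult_distrib)
      then have "\<bar>S (x - \<epsilon> * t) - (\<Sum>i\<le>m. c i * t ^ i)\<bar>
          \<le> M / fact (Suc m) * \<bar>x - \<epsilon> * t - x\<bar> ^ Suc m"
        using taylor_remainder_le[OF deriv M, where a = a and b = b and x = x and y = "x - \<epsilon> * t"]
          inside
        by (simp del: funpow.simps power_Suc fact_Suc)
      also have "\<dots> \<le> M / fact (Suc m) * \<epsilon> ^ Suc m"
        using \<open>M \<ge> 0\<close> \<epsilon>t by (intro mult_left_mono power_mono) auto
      finally show ?thesis .
    qed
    moreover have "continuous_on {x - \<epsilon>..x + \<epsilon>} S"
      using x by (intro continuous_on_subset[OF cont]) auto
    ultimately have "\<bar>convolution S (delta_reg m k \<epsilon>) x - c 0\<bar>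
        \<le> M / fact (Suc m) * \<epsilon> ^ Suc m
          * integral {-1..1} (\<lambda>t. \<bar>poly (delta_poly m k) t\<bar>)"
      using \<epsilon> by (intro convolution_delta_reg_error_le)
    then show ?thesis by (simp add: c_def C_def mult_ac)
  qed
  have "((\<lambda>\<epsilon>. convolution S (delta_reg m k \<epsilon>) x) \<longlongrightarrow> S x) (at_right 0)"
    if x: "x \<in> {a<..<b}" for x
  proof (rule LIM_zero_cancel, rule Lim_null_comparison)
    have "eventually (\<lambda>\<epsilon>. \<epsilon> \<in> {0<..<min (x - a) (b - x)}) (at_right (0::real))"
      using x by (intro eventually_at_right_real) auto
    then show "eventually (\<lambda>\<epsilon>. norm (convolution S (delta_reg m k \<epsilon>) x - S x)
        \<le> C * \<epsilon> ^ (m + 1)) (at_right 0)"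
    proof eventually_elim
      case (elim \<epsilon>)
      then show ?case using error[of \<epsilon> x] by auto
    qed
    have "((\<lambda>\<epsilon>. C * \<epsilon> ^ (m + 1)) \<longlongrightarrow> C * 0 ^ (m + 1)) (at_right (0::real))"
      by (intro tendsto_intros)
    then show "((\<lambda>\<epsilon>. C * \<epsilon> ^ (m + 1)) \<longlongrightarrow> 0) (at_right 0)" by simp
  qed
  then show ?thesis using error by blast
qed

end
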